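(* Let $A\in\mathcal{S}_m$ be a Sassenfeld matrix, let $b\in\mathbb{C}^m$, and let $P\in\mathcal{H}_m$ with $\mu(A,P)<1$. Then, for any starting vector $x_0\in\mathbb{C}^m$, the sequence $(x_n)_{n\ge 0}$ defined by the iteration $$Px_{n+1}=(P-A)x_n+b,\qquad n\ge 0,$$ converges to the unique solution $x\in\mathbb{C}^m$ of the linear system $Ax=b$. Furthermore, the a priori bound $$\|x-x_n\|_\infty\le\mu(A,P)^n\,\|x-x_0\|_\infty$$ holds for any $n\ge 0$.
   Context: For a complex matrix or vector $X$, $|X|$ denotes the matrix or vector of entrywise absolute values; $\operatorname{diag}(X)$ and $\operatorname{off}(X)=X-\operatorname{diag}(X)$ denote the diagonal part and the off-diagonal part of a square matrix $X$. For real matrices or vectors of the same size, $X\succeq Y$ (equivalently $Y\preceq X$) means that all entries of $X-Y$ are non-negative. $\|\cdot\|_\infty$ is the maximum norm on vectors, $I_m$ is the $m\times m$ identity matrix, $\varrho(\cdot)$ is the spectral radius, and $e=(1,\ldots,1)^\top\in\mathbb{R}^m$. Comparison matrix: for $A=[a_{ij}]\in\mathbb{C}^{m\times m}$, $\mathfrak{M}(A):=|\operatorname{diag}(A)|-|\operatorname{off}(A)|\in\mathbb{R}^{m\times m}$, i.e. $\mathfrak{M}(A)_{ii}=|a_{ii}|$ and $\mathfrak{M}(A)_{ij}=-|a_{ij}|$ for $i\neq j$. H-matrices: $\mathcal{H}_m$ is the set of all $A\in\mathbb{C}^{m\times m}$ for which $\mathfrak{M}(A)$ is a non-singular M-matrix,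 i.e. $\mathfrak{M}(A)=rI_m-B$ for some real matrix $B\succeq 0$ and some real $r>\varrho(B)$. (For $P\in\mathcal{H}_m$ both $P$ and $\mathfrak{M}(P)$ are invertible, and $\mathfrak{M}(P)^{-1}\succeq 0$.) Sassenfeld index: for $A\in\mathbb{C}^{m\times m}$ and $P\in\mathcal{H}_m$, put $s(A,P):=\mathfrak{M}(P)^{-1}|A-P|e\in\mathbb{R}^m$ and $\mu(A,P):=\|s(A,P)\|_\infty$. Sassenfeld matrices: $\mathcal{S}_m$ is the set of all $A\in\mathbb{C}^{m\times m}$ for which there exists $P\in\mathcal{H}_m$ with $\mu(A,P)<1$. Every Sassenfeld matrix is non-singular. *)

theory Defs
  imports "HOL-Analysis.Analysis"
begin

text \<open>
  Square matrices of size \<open>m\<close> are elements of \<^typ>\<open>'a^'m^'m\<close>, where \<open>m\<close> is the cardinality of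
  the finite index type \<open>'m\<close>. The library order on \<^typ>\<open>real^'m\<close> and
  \<^typ>\<open>real^'m^'m\<close> is the entrywise one.
\<close>

definition abs_matrix :: "complex^'n^'m \<Rightarrow> real^'n^'m" where
  "abs_matrix A = (\<chi> i j. cmod (A $ i $ j))"

definition diag_part :: "'a::zero^'m^'m \<Rightarrow> 'a^'m^'m" where
  "diag_part A = (\<chi> i j. if i = j then A $ i $ j else 0)"

definition off_part :: "'a::ab_group_add^'m^'m \<Rightarrow> 'a^'m^'m" where
  "off_part A = A - diag_part A"

definition comparison_matrix :: "complex^'m^'m \<Rightarrow> real^'m^'m" where
  "comparison_matrix A = abs_matrix (diag_part A) - abs_matrix (off_part A)"

text \<open>
  The library's \<^const>\<open>infnorm\<close> on \<^typ>\<open>complex^'m\<close> is the maximum of the absolute values of the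
  real and imaginary parts, which is not the maximum norm; hence the following definition.
\<close>

definition max_norm :: "'a::real_normed_vector^'m \<Rightarrow> real" where
  "max_norm x = Max (range (\<lambda>i. norm (x $ i)))"

definition eigenvalues :: "complex^'m^'m \<Rightarrow> complex set" where
  "eigenvalues A = {k. \<exists>v. v \<noteq> 0 \<and> A *v v = k *s v}"

definition spectral_radius :: "complex^'m^'m \<Rightarrow> real" where
  "spectral_radius A = Max (cmod ` eigenvalues A)"

definition complex_matrix :: "real^'n^'m \<Rightarrow> complex^'n^'m" where
  "complex_matrix B = (\<chi> i j. complex_of_real (B $ i $ j))"

text \<open>Here \<^term>\<open>mat r\<close> is \<open>r\<close> times the identity matrix.\<close>

definition nonsingular_M_matrix :: "real^'m^'m \<Rightarrow> bool" where
  "nonsingular_M_matrix M \<longleftrightarrow>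
     (\<exists>r B. M = mat r - B \<and> 0 \<le> B \<and> spectral_radius (complex_matrix B) < r)"

definition H_matrices :: "(complex^'m^'m) set" where
  "H_matrices = {A. nonsingular_M_matrix (comparison_matrix A)}"

text \<open>Here \<^term>\<open>vec 1\<close> is the all-ones vector.\<close>

definition sassenfeld_vector :: "complex^'m^'m \<Rightarrow> complex^'m^'m \<Rightarrow> real^'m" where
  "sassenfeld_vector A P = matrix_inv (comparison_matrix P) *v (abs_matrix (A - P) *v vec 1)"

definition sassenfeld_index :: "complex^'m^'m \<Rightarrow> complex^'m^'m \<Rightarrow> real" where
  "sassenfeld_index A P = max_norm (sassenfeld_vector A P)"

definition sassenfeld_matrices :: "(complex^'m^'m) set" where
  "sassenfeld_matrices = {A. \<exists>P\<in>H_matrices. sassenfeld_index A P < 1}"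

definition is_iteration ::
    "complex^'m^'m \<Rightarrow> complex^'m^'m \<Rightarrow> complex^'m \<Rightarrow> complex^'m \<Rightarrow> (nat \<Rightarrow> complex^'m) \<Rightarrow> bool" where
  "is_iteration A P b x0 X \<longleftrightarrow> X 0 = x0 \<and> (\<forall>n. P *v X (Suc n) = (P - A) *v X n + b)"

end

theory Submission
  imports Defs "HOL-Computational_Algebra.Polynomial"
begin

text \<open>
  If \<open>M = \<MM>(P)\<close> is a non-singular M-matrix, then \<open>M w = e\<close> for some entrywise positive \<open>w\<close>, whence
  \<open>M y \<succeq> 0\<close> implies \<open>y \<succeq> 0\<close>. If \<open>P u = (P - A) v\<close>, then
  \<open>M |u| \<preceq> |P u| \<preceq> |P - A| |v| \<preceq> \<parallel>v\<parallel> |P - A| e = \<parallel>v\<parallel> M s(A, P)\<close>, hence \<open>|u| \<preceq> \<parallel>v\<parallel> s(A, P)\<close> and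
  \<open>\<parallel>u\<parallel> \<le> \<mu>(A, P) \<parallel>v\<parallel>\<close>. Applied to \<open>u = v\<close> this gives the invertibility of \<open>A\<close>; applied to
  consecutive errors it gives the a priori bound.

  The vector \<open>w\<close> comes from a connectedness argument that avoids the Perron-Frobenius theorem: for
  \<open>M = r I - B\<close> the solution \<open>x t\<close> of \<open>(t I - B) x t = e\<close> depends continuously on \<open>t \<ge> r\<close>, is
  positive for large \<open>t\<close>, and can never be non-negative with a zero entry, because \<open>B \<succeq> 0\<close>.
\<close>

section \<open>Maximum norm\<close>

lemma norm_nth_le_max_norm: "norm (x $ i) \<le> max_norm x"
  by (simp add: max_norm_def)

lemma max_norm_le_iff: "max_norm x \<le> c \<longleftrightarrow> (\<forall>i. norm (x $ i) \<le> c)"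
  by (simp add: max_norm_def)

lemma max_norm_nonneg: "0 \<le> max_norm x"
  by (rule order_trans[OF norm_ge_zero norm_nth_le_max_norm[of x undefined]])

lemma max_norm_le_0_iff: "max_norm x \<le> 0 \<longleftrightarrow> x = 0"
  by (simp add: max_norm_le_iff vec_eq_iff)

section \<open>Finiteness of the spectrum\<close>

lemma mat_diff_mult_vec:
  fixes A :: "'a::comm_ring_1^'m^'m"
  shows "(mat k - A) *v x = k *s x - A *v x"
proof -
  have "mat k *v x = k *s x"
    by (simp add: vec_eq_iff matrix_vector_mult_def mat_def if_distrib if_distribR cong: if_cong)
  then show ?thesis
    by (simp add: vec_eq_iff matrix_vector_mult_def left_diff_distrib sum_subtractf)
qed

lemma det_eq_0_iff_kernel:
  fixes A :: "'a::field^'m^'m"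
  shows "det A = 0 \<longleftrightarrow> (\<exists>v. v \<noteq> 0 \<and> A *v v = 0)"
proof -
  have "det A \<noteq> 0 \<longleftrightarrow> (\<forall>v. A *v v = 0 \<longrightarrow> v = 0)"
    unfolding invertible_det_nz[symmetric] invertible_left_inverse
    by (rule matrix_left_invertible_ker)
  then show ?thesis
    by blast
qed

lemma eigenvalues_eq_det: "eigenvalues A = {k. det (mat k - A) = 0}"
  unfolding eigenvalues_def det_eq_0_iff_kernel mat_diff_mult_vec by auto

text \<open>A crude bound for the operator norm induced by \<open>max_norm\<close>; it only serves
  to exhibit a number outside the spectrum.\<close>

definition entry_sum :: "complex^'m^'m \<Rightarrow> real" where
  "entry_sum A = (\<Sum>i\<in>UNIV. \<Sum>j\<in>UNIV. cmod (A $ i $ j))"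

lemma max_norm_mult_vec_le:
  fixes A :: "complex^'m^'m"
  shows "max_norm (A *v v) \<le> entry_sum A * max_norm v"
  unfolding max_norm_le_iff
proof
  fix i
  have "cmod ((A *v v) $ i) \<le> (\<Sum>j\<in>UNIV. cmod (A $ i $ j) * cmod (v $ j))"
    unfolding matrix_vector_mult_def by (simp add: norm_mult sum_norm_le)
  also have "\<dots> \<le> (\<Sum>j\<in>UNIV. cmod (A $ i $ j)) * max_norm v"
    unfolding sum_distrib_right
    by (intro sum_mono mult_left_mono norm_nth_le_max_norm) simp
  also have "\<dots> \<le> entry_sum A * max_norm v"
    unfolding entry_sum_def
    by (intro mult_right_mono max_norm_nonneg
        member_le_sum[where f = "\<lambda>i. \<Sum>j\<in>UNIV. cmod (A $ i $ j)"]) (auto intro: sum_nonneg)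
  finally show "cmod ((A *v v) $ i) \<le> entry_sum A * max_norm v" .
qed

lemma eigenvalue_bound:
  assumes "k \<in> eigenvalues A"
  shows "cmod k \<le> entry_sum A"
proof -
  obtain v where v: "v \<noteq> 0" "A *v v = k *s v"
    using assms by (auto simp: eigenvalues_def)
  have pos: "max_norm v > 0"
    using v(1) max_norm_le_0_iff[of v] by linarith
  have "cmod (v $ i) * cmod k \<le> entry_sum A * max_norm v" for i
    using max_norm_mult_vec_le[of A v] unfolding v(2) max_norm_le_iff
    by (simp add: norm_mult mult.commute)
  \<comment> \<open>At an index where the modulus of the entry is maximal, the positive factor
    \<open>max_norm v\<close> cancels.\<close>
  moreover have "max_norm v \<in> range (\<lambda>i. cmod (v $ i))"
    unfolding max_norm_def by (rule Max_in) simp_all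
  then obtain i where "max_norm v = cmod (v $ i)"
    by blast
  ultimately show ?thesis
    using pos by (metis mult.commute mult_le_cancel_right_pos)
qed

text \<open>This makes the \<open>Max\<close> in \<open>spectral_radius\<close> an upper bound.
  Eigenvalues are the roots of the characteristic polynomial \<open>det C\<close>, which is nonzero
  because it does not vanish beyond the bound \<open>entry_sum A\<close>.\<close>

lemma finite_eigenvalues:
  fixes A :: "complex^'m^'m"
  shows "finite (eigenvalues A)"
proof -
  define C :: "complex poly^'m^'m"
    where "C = (\<chi> i j. [: - (A $ i $ j), if i = j then 1 else 0 :])"
  have poly_C: "poly (det C) k = det (mat k - A)" for k
  proof -
    have "poly (C $ i $ j) k = (mat k - A) $ i $ j" for i j
      by (simp add: C_def mat_def)
    then show ?thesis
      unfolding det_def by (simp add: poly_sum poly_prod)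
  qed
  have "complex_of_real (\<bar>entry_sum A\<bar> + 1) \<notin> eigenvalues A"
    using eigenvalue_bound[of "complex_of_real (\<bar>entry_sum A\<bar> + 1)" A]
    unfolding norm_of_real by linarith
  then have "det C \<noteq> 0"
    unfolding eigenvalues_eq_det by (auto simp flip: poly_C)
  then show ?thesis
    unfolding eigenvalues_eq_det poly_C[symmetric] by (rule poly_roots_finite)
qed

lemma spectral_radius_ge: "k \<in> eigenvalues A \<Longrightarrow> cmod k \<le> spectral_radius A"
  unfolding spectral_radius_def by (simp add: finite_eigenvalues)

text \<open>A real kernel vector, read over the complex numbers, would make \<open>t\<close> an
  eigenvalue, whose modulus is at least \<open>t\<close> and thus exceeds the spectral
  radius.\<close>

lemma det_mat_diff_nonzero:
  fixes B :: "real^'m^'m"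
  assumes "spectral_radius (complex_matrix B) < t"
  shows "det (mat t - B) \<noteq> 0"
proof
  assume "det (mat t - B) = 0"
  then obtain v where v: "v \<noteq> 0" "B *v v = t *s v"
    unfolding det_eq_0_iff_kernel mat_diff_mult_vec by auto
  define z where "z = (\<chi> i. complex_of_real (v $ i))"
  have "complex_matrix B *v z = complex_of_real t *s z"
    unfolding vec_eq_iff
  proof
    fix i
    have "(complex_matrix B *v z) $ i = complex_of_real ((B *v v) $ i)"
      by (simp add: complex_matrix_def z_def matrix_vector_mult_def)
    then show "(complex_matrix B *v z) $ i = (complex_of_real t *s z) $ i"
      by (simp add: v(2) z_def)
  qed
  moreover have "z \<noteq> 0"
    using v(1) by (simp add: z_def vec_eq_iff)
  ultimately have "complex_of_real t \<in> eigenvalues (complex_matrix B)"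
    by (auto simp: eigenvalues_def)
  from spectral_radius_ge[OF this] assms show False
    by simp
qed

section \<open>Monotone matrices\<close>

text \<open>Let \<open>c\<close> be the least ratio \<open>y $ j / w $ j\<close>, attained at
  \<open>i\<close>. Then \<open>y\<close> dominates \<open>c *s w\<close> with equality at
  \<open>i\<close>, so the off-diagonal signs give
  \<open>0 \<le> (M *v y) $ i \<le> c * (M *v w) $ i\<close>. Hence \<open>c \<ge> 0\<close>, and
  \<open>y\<close> is non-negative.\<close>

lemma Z_matrix_monotone:
  fixes M :: "real^'m^'m"
  assumes off: "\<And>i j. i \<noteq> j \<Longrightarrow> M $ i $ j \<le> 0"
    and w: "\<And>i. w $ i > 0" "\<And>i. (M *v w) $ i > 0"
    and y: "0 \<le> M *v y"
  shows "0 \<le> y"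
proof -
  obtain i where i: "\<And>j. y $ i / w $ i \<le> y $ j / w $ j"
    using ex_min_if_finite[of "range (\<lambda>j. y $ j / w $ j)"] by (fastforce simp: not_less)
  define c where "c = y $ i / w $ i"
  have cw: "c * w $ j \<le> y $ j" for j
    using i[of j] w(1)[of j] by (simp add: c_def pos_le_divide_eq)
  have ci: "c * w $ i = y $ i"
    using w(1)[of i] by (simp add: c_def)
  have "(M *v y) $ i \<le> (\<Sum>j\<in>UNIV. M $ i $ j * (c * w $ j))"
    unfolding matrix_vector_mult_def vec_lambda_beta
  proof (rule sum_mono)
    fix j
    show "M $ i $ j * y $ j \<le> M $ i $ j * (c * w $ j)"
      using off[of i j] cw[of j] ci by (cases "i = j") (auto intro: mult_left_mono_neg)
  qed
  also have "\<dots> = c * (M *v w) $ i"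
    by (simp add: matrix_vector_mult_def sum_distrib_left algebra_simps)
  finally have "0 \<le> c * (M *v w) $ i"
    using y by (auto simp: less_eq_vec_def intro: order_trans)
  then have "0 \<le> c"
    using w(2)[of i] by (simp add: zero_le_mult_iff)
  then show ?thesis
    unfolding less_eq_vec_def using cw w(1)
    by (metis less_imp_le mult_nonneg_nonneg order_trans zero_index)
qed

section \<open>Positive vectors for non-singular M-matrices\<close>

lemma continuous_on_det:
  fixes F :: "real \<Rightarrow> real^'m^'m"
  assumes "\<And>i j. continuous_on S (\<lambda>t. F t $ i $ j)"
  shows "continuous_on S (\<lambda>t. det (F t))"
  unfolding det_def by (intro continuous_intros assms)

lemma nonsingular_M_matrix_positive_vector:
  fixes M :: "real^'m^'m"
  assumes "nonsingular_M_matrix M"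
  obtains w where "\<And>i. w $ i > 0" and "M *v w = vec 1"
proof -
  obtain r B where M: "M = mat r - B" and B: "0 \<le> B"
    and r: "spectral_radius (complex_matrix B) < r"
    using assms by (auto simp: nonsingular_M_matrix_def)
  have B_nonneg: "0 \<le> B $ i $ j" for i j
    using B by (simp add: less_eq_vec_def)
  \<comment> \<open>Cramer's formula: as a quotient of determinants, the solution is visibly
    continuous in \<open>t\<close>.\<close>
  define x :: "real \<Rightarrow> real^'m" where
    "x t = (\<chi> k. det (\<chi> i j. if j = k then (vec 1 :: real^'m) $ i else (mat t - B) $ i $ j)
                  / det (mat t - B))" for t
  have x: "(mat t - B) *v x t = vec 1" if "r \<le> t" for t
    using cramer[of "mat t - B" "x t" "vec 1"] det_mat_diff_nonzero[of B t] r that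
    by (simp add: x_def)
  have x_nth: "t * x t $ i = 1 + (\<Sum>j\<in>UNIV. B $ i $ j * x t $ j)" if "r \<le> t" for t i
    using arg_cong[OF x[OF that, unfolded mat_diff_mult_vec], of "\<lambda>v. v $ i"]
    by (simp add: matrix_vector_mult_def)
  \<comment> \<open>A zero entry would turn \<open>x_nth\<close> into 0 = 1 + a non-negative
    sum.\<close>
  have pos: "x t $ i > 0" if "r \<le> t" "0 \<le> x t" for t i
  proof -
    have "0 \<le> (\<Sum>j\<in>UNIV. B $ i $ j * x t $ j)"
      using that(2) by (intro sum_nonneg mult_nonneg_nonneg B_nonneg) (simp add: less_eq_vec_def)
    then have "x t $ i \<noteq> 0"
      using x_nth[OF that(1), of i] by auto
    then show ?thesis
      using that(2) by (simp add: less_eq_vec_def order_less_le)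
  qed
  have entry: "continuous_on {r..} (\<lambda>t. (mat t - B) $ i $ j)" for i j
    by (cases "i = j") (auto simp: mat_def intro!: continuous_intros)
  have "continuous_on {r..} (\<lambda>t. x t $ k)" for k
    unfolding x_def vec_lambda_beta
  proof (intro continuous_on_divide continuous_on_det ballI entry)
    fix i j
    show "continuous_on {r..} (\<lambda>t. (\<chi> i j. if j = k then (vec 1 :: real^'m) $ i
        else (mat t - B) $ i $ j) $ i $ j)"
      using entry[of i j] by (cases "j = k") simp_all
  qed (use r in \<open>simp add: det_mat_diff_nonzero\<close>)
  then have "continuous_on {r..} (\<lambda>t. \<chi> k. x t $ k)"
    by (intro continuous_on_vec_lambda)
  then have conn: "connected (x ` {r..})"
    by (intro connected_continuous_image) simp_all
  \<comment> \<open>\<open>U\<close> is the open positive orthant, \<open>V\<close> the open set of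
    vectors with some negative entry. They are disjoint and by \<open>pos\<close> cover the
    connected curve, which therefore misses one of them.\<close>
  define U where "U = (\<Inter>i. {y :: real^'m. 0 < y $ i})"
  define V where "V = (\<Union>i. {y :: real^'m. y $ i < 0})"
  have "open U" "open V"
    unfolding U_def V_def
    by (auto intro!: open_INT open_UN open_Collect_less continuous_intros)
  moreover have "x ` {r..} \<subseteq> U \<union> V"
    using pos by (fastforce simp: U_def V_def less_eq_vec_def not_less)
  moreover have "U \<inter> V \<inter> x ` {r..} = {}"
    by (force simp: U_def V_def)
  ultimately have UV: "U \<inter> x ` {r..} = {} \<or> V \<inter> x ` {r..} = {}"
    using conn by (intro connectedD)
  \<comment> \<open>\<open>T\<close> exceeds every row sum of \<open>B\<close> by at least 1, so
    \<open>mat T - B\<close> maps \<open>vec 1\<close> to a positive vector; the term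
    \<open>\<bar>r\<bar>\<close> secures \<open>r \<le> T\<close>.\<close>
  define T where "T = \<bar>r\<bar> + 1 + (\<Sum>i\<in>UNIV. \<Sum>j\<in>UNIV. B $ i $ j)"
  have row: "(\<Sum>j\<in>UNIV. B $ i $ j) \<le> (\<Sum>i\<in>UNIV. \<Sum>j\<in>UNIV. B $ i $ j)" for i
    by (rule member_le_sum[where f = "\<lambda>i. \<Sum>j\<in>UNIV. B $ i $ j"])
      (auto intro: sum_nonneg B_nonneg)
  have "r \<le> T"
    using row[of undefined] sum_nonneg[of UNIV "\<lambda>j. B $ undefined $ j"] B_nonneg
    unfolding T_def by fastforce
  have "0 \<le> x T"
  proof (rule Z_matrix_monotone[where M = "mat T - B" and w = "vec 1"])
    show "(mat T - B) $ i $ j \<le> 0" if "i \<noteq> j" for i j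
      using that B_nonneg by (simp add: mat_def)
    show "((mat T - B) *v vec 1) $ i > 0" for i
      unfolding mat_diff_mult_vec using row[of i] by (simp add: matrix_vector_mult_def T_def)
    show "0 \<le> (mat T - B) *v x T"
      by (simp add: x[OF \<open>r \<le> T\<close>] less_eq_vec_def)
  qed simp
  then have "x T \<in> U \<inter> x ` {r..}"
    using pos[OF \<open>r \<le> T\<close>] \<open>r \<le> T\<close> by (simp add: U_def)
  \<comment> \<open>The curve meets \<open>U\<close> at \<open>T\<close>, so it misses
    \<open>V\<close> everywhere, in particular at the endpoint \<open>r\<close>.\<close>
  with UV have "x r \<notin> V"
    by auto
  then have "0 \<le> x r"
    by (simp add: V_def less_eq_vec_def not_less)
  then show ?thesis
    using that[of "x r"] pos[of r] x[of r] M by simp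
qed

section \<open>H-matrices and the Sassenfeld index\<close>

lemma comparison_matrix_nth:
  "comparison_matrix P $ i $ j = (if i = j then cmod (P $ i $ j) else - cmod (P $ i $ j))"
  by (simp add: comparison_matrix_def abs_matrix_def diag_part_def off_part_def)

lemma comparison_matrix_monotone:
  assumes "P \<in> H_matrices" and "0 \<le> comparison_matrix P *v y"
  shows "0 \<le> y"
proof -
  obtain w where w: "\<And>i. w $ i > 0" "comparison_matrix P *v w = vec 1"
    using assms(1) nonsingular_M_matrix_positive_vector unfolding H_matrices_def by blast
  show ?thesis
    by (rule Z_matrix_monotone[of "comparison_matrix P" w])
      (use w assms(2) in \<open>simp_all add: comparison_matrix_nth\<close>)
qed

lemma comparison_matrix_mult_inv:
  assumes "P \<in> H_matrices"
  shows "comparison_matrix P *v (matrix_inv (comparison_matrix P) *v y) = y"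
proof -
  have "x = 0" if x: "comparison_matrix P *v x = 0" for x
  proof -
    \<comment> \<open>Monotonicity applied to both \<open>x\<close> and \<open>- x\<close> forces a
      trivial kernel.\<close>
    have "0 \<le> x" "0 \<le> - x"
      by (rule comparison_matrix_monotone[OF assms], simp add: x vec.neg)+
    then show ?thesis
      by (simp add: less_eq_vec_def vec_eq_iff order_antisym)
  qed
  then have "\<exists>M'. comparison_matrix P ** M' = mat 1 \<and> M' ** comparison_matrix P = mat 1"
    using invertible_left_inverse matrix_left_invertible_ker unfolding invertible_def by blast
  \<comment> \<open>\<open>matrix_inv\<close> is defined by choice, so its inverse property follows
    once a two-sided inverse exists.\<close>
  from someI_ex[OF this] have "comparison_matrix P ** matrix_inv (comparison_matrix P) = mat 1"
    unfolding matrix_inv_def by blast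
  then show ?thesis
    by (simp add: matrix_vector_mul_assoc)
qed

text \<open>Reverse triangle inequality in row \<open>i\<close>, with the diagonal term split off
  from the others.\<close>

lemma comparison_matrix_abs_le:
  fixes u :: "complex^'m"
  shows "(comparison_matrix P *v (\<chi> j. cmod (u $ j))) $ i \<le> cmod ((P *v u) $ i)"
proof -
  have split: "sum f UNIV = f i + sum f (UNIV - {i})" for f :: "'m \<Rightarrow> 'b::comm_monoid_add"
    by (simp add: sum.remove)
  have "(comparison_matrix P *v (\<chi> j. cmod (u $ j))) $ i
      = cmod (P $ i $ i * u $ i) - (\<Sum>j\<in>UNIV - {i}. cmod (P $ i $ j * u $ j))"
    unfolding matrix_vector_mult_def vec_lambda_beta split
    by (simp add: comparison_matrix_nth norm_mult flip: sum_negf)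
  also have "\<dots> \<le> cmod (P $ i $ i * u $ i) - cmod (\<Sum>j\<in>UNIV - {i}. P $ i $ j * u $ j)"
    using norm_sum[of "\<lambda>j. P $ i $ j * u $ j" "UNIV - {i}"] by simp
  also have "\<dots> \<le> cmod ((P *v u) $ i)"
    unfolding matrix_vector_mult_def vec_lambda_beta split
    using norm_triangle_ineq2[of "P $ i $ i * u $ i" "- (\<Sum>j\<in>UNIV - {i}. P $ i $ j * u $ j)"]
    by simp
  finally show ?thesis .
qed

lemma sassenfeld_contraction:
  assumes P: "P \<in> H_matrices" and uv: "P *v u = (P - A) *v v"
  shows "max_norm u \<le> sassenfeld_index A P * max_norm v"
proof -
  define s where "s = sassenfeld_vector A P"
  have Ms: "comparison_matrix P *v s = abs_matrix (A - P) *v vec 1"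
    unfolding s_def sassenfeld_vector_def by (rule comparison_matrix_mult_inv[OF P])
  \<comment> \<open>The bound is proved after applying the comparison matrix, where
    \<open>Ms\<close> makes it explicit, and then pulled back by monotonicity.\<close>
  have "0 \<le> comparison_matrix P *v (max_norm v *s s - (\<chi> j. cmod (u $ j)))"
    unfolding less_eq_vec_def
  proof
    fix i
    have "(comparison_matrix P *v (\<chi> j. cmod (u $ j))) $ i \<le> cmod (((P - A) *v v) $ i)"
      using comparison_matrix_abs_le[of P u i] by (simp add: uv)
    also have "\<dots> \<le> (\<Sum>j\<in>UNIV. cmod ((A - P) $ i $ j) * cmod (v $ j))"
      unfolding matrix_vector_mult_def
      by (simp add: norm_mult norm_minus_commute sum_norm_le)
    also have "\<dots> \<le> (\<Sum>j\<in>UNIV. cmod ((A - P) $ i $ j) * max_norm v)"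
      by (intro sum_mono mult_left_mono norm_nth_le_max_norm) simp
    also have "\<dots> = max_norm v * (comparison_matrix P *v s) $ i"
      unfolding Ms by (simp add: matrix_vector_mult_def abs_matrix_def sum_distrib_left mult.commute)
    finally show "0 $ i \<le> (comparison_matrix P *v (max_norm v *s s - (\<chi> j. cmod (u $ j)))) $ i"
      by (simp add: vec.diff vec.scale)
  qed
  then have "0 \<le> max_norm v *s s - (\<chi> j. cmod (u $ j))"
    by (rule comparison_matrix_monotone[OF P])
  then have us: "cmod (u $ i) \<le> max_norm v * s $ i" for i
    by (simp add: less_eq_vec_def)
  have "max_norm v * s $ i \<le> max_norm v * sassenfeld_index A P" for i
    using norm_nth_le_max_norm[of s i] unfolding sassenfeld_index_def s_def
    by (intro mult_left_mono max_norm_nonneg) simp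
  with us show ?thesis
    unfolding max_norm_le_iff by (metis mult.commute order_trans)
qed

text \<open>The contraction estimate with \<open>A = P\<close> and \<open>v = 0\<close>, whose
  right-hand side vanishes.\<close>

lemma H_matrix_kernel:
  assumes "P \<in> H_matrices" and "P *v u = 0"
  shows "u = 0"
proof -
  have "max_norm u \<le> sassenfeld_index P P * max_norm (0 :: complex^'a)"
    by (rule sassenfeld_contraction[OF assms(1)]) (simp add: assms(2))
  then show ?thesis
    by (simp add: max_norm_le_0_iff[symmetric] max_norm_def)
qed

lemma sassenfeld_kernel:
  assumes "P \<in> H_matrices" and "sassenfeld_index A P < 1" and "A *v u = 0"
  shows "u = 0"
proof -
  have "P *v u = (P - A) *v u"
    using assms(3) by (simp add: matrix_vector_mult_diff_rdistrib)
  then have "max_norm u \<le> sassenfeld_index A P * max_norm u"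
    by (rule sassenfeld_contraction[OF assms(1)])
  with assms(2) have "max_norm u \<le> 0"
    by (metis linorder_not_le mult_le_cancel_right1)
  then show ?thesis
    by (simp add: max_norm_le_0_iff)
qed

section \<open>Unique solvability and convergence of the iteration\<close>

lemma ex1_solution:
  fixes A :: "'a::field^'m^'m"
  assumes "\<And>v. A *v v = 0 \<Longrightarrow> v = 0"
  shows "\<exists>!x. A *v x = b"
proof -
  have "det A \<noteq> 0"
    using assms det_eq_0_iff_kernel[of A] by metis
  show ?thesis
    \<comment> \<open>Cramer's rule rewrites the system as \<open>x\<close> = an explicit vector,
      giving existence and uniqueness at once.\<close>
    by (subst cramer[OF \<open>det A \<noteq> 0\<close>]) (rule ex1_eq)
qed

lemma ex1_iteration:
  fixes P :: "complex^'m^'m"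
  assumes "P \<in> H_matrices"
  shows "\<exists>!X. is_iteration A P b x0 X"
proof -
  have "\<exists>!x. P *v x = c" for c
    using H_matrix_kernel[OF assms] by (rule ex1_solution)
  \<comment> \<open>With the solution operator \<open>g\<close> of \<open>P\<close>, being an
    iteration amounts to equality with one recursively defined sequence.\<close>
  then obtain g where g: "P *v x = c \<longleftrightarrow> x = g c" for x c
    by metis
  have "is_iteration A P b x0 X \<longleftrightarrow> X = rec_nat x0 (\<lambda>_ x. g ((P - A) *v x + b))" for X
  proof
    assume X: "is_iteration A P b x0 X"
    show "X = rec_nat x0 (\<lambda>_ x. g ((P - A) *v x + b))"
    proof
      fix n
      show "X n = rec_nat x0 (\<lambda>_ x. g ((P - A) *v x + b)) n"
        using X by (induction n) (simp_all add: is_iteration_def g)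
    qed
  qed (simp add: is_iteration_def g)
  then show ?thesis
    by auto
qed

lemma iteration_error:
  assumes P: "P \<in> H_matrices" and x: "A *v x = b" and X: "is_iteration A P b x0 X"
  shows "max_norm (x - X n) \<le> sassenfeld_index A P ^ n * max_norm (x - x0)"
proof (induction n)
  case 0
  then show ?case
    using X by (simp add: is_iteration_def)
next
  case (Suc n)
  \<comment> \<open>The exact solution is a fixed point of the iteration, so \<open>b\<close>
    cancels in the error recursion.\<close>
  have "P *v (x - X (Suc n)) = (P - A) *v (x - X n)"
    using X x by (simp add: is_iteration_def vec.diff matrix_vector_mult_diff_rdistrib)
  then have "max_norm (x - X (Suc n)) \<le> sassenfeld_index A P * max_norm (x - X n)"
    by (rule sassenfeld_contraction[OF P])
  also have "\<dots> \<le> sassenfeld_index A P * (sassenfeld_index A P ^ n * max_norm (x - x0))"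
    by (intro mult_left_mono Suc.IH) (simp add: sassenfeld_index_def max_norm_nonneg)
  finally show ?case
    by simp
qed

theorem proposition4p5:
  fixes A P :: "complex^'m^'m" and b :: "complex^'m"
  assumes "A \<in> sassenfeld_matrices"
    and "P \<in> H_matrices"
    and "sassenfeld_index A P < 1"
  shows "\<exists>x. A *v x = b \<and> (\<forall>y. A *v y = b \<longrightarrow> y = x) \<and>
    (\<forall>x0. (\<exists>!X. is_iteration A P b x0 X) \<and>
      (\<forall>X. is_iteration A P b x0 X \<longrightarrow>
        X \<longlonglongrightarrow> x \<and>
        (\<forall>n. max_norm (x - X n) \<le> sassenfeld_index A P ^ n * max_norm (x - x0))))"
proof -
  have "\<exists>!x. A *v x = b"
    using sassenfeld_kernel[OF assms(2,3)] by (rule ex1_solution)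
  then obtain x where x: "A *v x = b" "\<And>y. A *v y = b \<Longrightarrow> y = x"
    by blast
  have "X \<longlonglongrightarrow> x" if X: "is_iteration A P b x0 X" for x0 X
  proof (rule vec_tendstoI)
    fix i
    \<comment> \<open>The index is non-negative as a maximum norm and below 1 by assumption, so its
      powers vanish in the limit.\<close>
    have "(\<lambda>n. sassenfeld_index A P ^ n) \<longlonglongrightarrow> 0"
      using assms(3) by (intro LIMSEQ_realpow_zero) (simp_all add: sassenfeld_index_def max_norm_nonneg)
    then have lim: "(\<lambda>n. sassenfeld_index A P ^ n * max_norm (x - x0)) \<longlonglongrightarrow> 0"
      by (rule tendsto_mult_left_zero)
    have "norm (X n $ i - x $ i) \<le> sassenfeld_index A P ^ n * max_norm (x - x0)" for n
      using norm_nth_le_max_norm[of "x - X n" i] iteration_error[OF assms(2) x(1) X, of n]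
      by (simp add: norm_minus_commute)
    then have "(\<lambda>n. X n $ i - x $ i) \<longlonglongrightarrow> 0"
      by (intro Lim_null_comparison[OF _ lim]) simp
    then show "(\<lambda>n. X n $ i) \<longlonglongrightarrow> x $ i"
      by (rule LIM_zero_cancel)
  qed
  then show ?thesis
    using x ex1_iteration[OF assms(2)] iteration_error[OF assms(2) x(1)] by blast
qed

end
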